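(* Let $\lambda\supseteq\mu$ be strict partitions and $n$ a positive integer such that $\mathrm{SSVT}_P(\lambda/\mu,n)\neq\emptyset$ and $\mathrm{SSVT}_Q(\lambda/\mu,n)\neq\emptyset$. Then, as Laurent polynomials in $\beta$, $$GP_{\lambda/\mu}(\beta,\dots,\beta \mid -\beta^{-1})=\beta^{|\lambda/\mu|},\qquad GQ_{\lambda/\mu}(\beta,\dots,\beta \mid -\beta^{-1})=\beta^{|\lambda/\mu|},$$ where all $n$ variables are specialized to $\beta$ and the parameter to $-\beta^{-1}$.
   Context: Strict partitions $\lambda=(\lambda_1>\dots>\lambda_r>0)$, $\ell(\lambda)=r$, $|\lambda|=\sum\lambda_i$. For strict partitions with $\lambda_i\ge\mu_i$ for all $i$ (pad $\mu$ with zeros) write $\lambda\supseteq\mu$. The shifted skew diagram is $\lambda/\mu=\{(i,j): 1\le i\le\ell(\lambda),\ \mu_i+i\le j\le\lambda_i+i-1\}$, $|\lambda/\mu|=|\lambda|-|\mu|$ is its number of boxes, and boxes of the form $(i,i)$ are called diagonal. For $k\in[n]$ put $k'=k-\tfrac12$ and $[n',n]=\{1'<1<2'<2<\dots<n'<n\}$. A shifted skew set-valued tableau of shape $\lambda/\mu$ with $n$ variables assigns to each box $(i,j)\in\lambda/\mu$ a nonempty subset $T_{i,j}\subseteq[n',n]$ such that: (1) $\max T_{i,j}\le\min T_{i,j+1}$ and $\max T_{i,j}\le\min T_{i+1,j}$ whenever both boxes are in $\lambda/\mu$; (2) each unprimed $k$ appears at most once in each column; (3) each primed $k'$ appears at most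 once in each row; (4) diagonal boxes contain only unprimed entries. $\mathrm{SSVT}_P(\lambda/\mu,n)$ is the set of these; $\mathrm{SSVT}_Q(\lambda/\mu,n)$ is the set satisfying (1)–(3) only. $|T|$ is the total number of entries, $\omega_k(T)$ the number of occurrences of $k$ or $k'$, $x^{\omega(T)}=\prod_k x_k^{\omega_k(T)}$. Define $GP_{\lambda/\mu}(x\mid\beta)=\sum_{T\in\mathrm{SSVT}_P(\lambda/\mu,n)}\beta^{|T|-|\lambda/\mu|}x^{\omega(T)}$ and $GQ_{\lambda/\mu}(x\mid\beta)=\sum_{T\in\mathrm{SSVT}_Q(\lambda/\mu,n)}\beta^{|T|-|\lambda/\mu|}x^{\omega(T)}$. *)

theory Defs
  imports Complex_Main "HOL-Library.Poly_Mapping"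
begin

subsection \<open>Strict partitions and shifted skew diagrams\<close>

definition strict_partition :: "nat list \<Rightarrow> bool" where
  "strict_partition lam \<longleftrightarrow> sorted_wrt (>) lam \<and> (\<forall>a\<in>set lam. a > 0)"

text \<open>Parts are indexed from 1 and padded with zeros.\<close>

definition part :: "nat list \<Rightarrow> nat \<Rightarrow> nat" where
  "part lam i = (if 1 \<le> i \<and> i \<le> length lam then lam ! (i - 1) else 0)"

definition part_contains :: "nat list \<Rightarrow> nat list \<Rightarrow> bool" where
  "part_contains lam mu \<longleftrightarrow> (\<forall>i\<ge>1. part lam i \<ge> part mu i)"

definition diagram :: "nat list \<Rightarrow> nat list \<Rightarrow> (nat \<times> nat) set" where
  "diagram lam mu =
     {(i, j). 1 \<le> i \<and> i \<le> length lam \<and> part mu i + i \<le> j \<and> j \<le> part lam i + i - 1}"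

definition skew_size :: "nat list \<Rightarrow> nat list \<Rightarrow> nat" where
  "skew_size lam mu = sum_list lam - sum_list mu"

subsection \<open>Set-valued tableaux\<close>

text \<open>The alphabet is literally a set of half-integers, ordered as rational numbers.\<close>

definition unprimed :: "nat \<Rightarrow> rat" where
  "unprimed k = of_nat k"

definition primed :: "nat \<Rightarrow> rat" where
  "primed k = of_nat k - 1 / 2"

definition alphabet :: "nat \<Rightarrow> rat set" where
  "alphabet n = unprimed ` {1..n} \<union> primed ` {1..n}"

text \<open>
  A filling is a function on all of \<^typ>\<open>nat \<times> nat\<close>.  It is required to be empty off the
  diagram, so that each tableau is represented by exactly one function.
\<close>

definition SSVT_Q :: "nat list \<Rightarrow> nat list \<Rightarrow> nat \<Rightarrow> (nat \<times> nat \<Rightarrow> rat set) set" where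
  "SSVT_Q lam mu n = {T.
     (\<forall>b\<in>diagram lam mu. T b \<noteq> {} \<and> T b \<subseteq> alphabet n) \<and>
     (\<forall>b. b \<notin> diagram lam mu \<longrightarrow> T b = {}) \<and>
     (\<forall>i j. (i, j) \<in> diagram lam mu \<and> (i, j + 1) \<in> diagram lam mu \<longrightarrow>
        Max (T (i, j)) \<le> Min (T (i, j + 1))) \<and>
     (\<forall>i j. (i, j) \<in> diagram lam mu \<and> (i + 1, j) \<in> diagram lam mu \<longrightarrow>
        Max (T (i, j)) \<le> Min (T (i + 1, j))) \<and>
     (\<forall>k\<in>{1..n}. \<forall>j. \<exists>\<^sub>\<le>\<^sub>1 i. unprimed k \<in> T (i, j)) \<and>
     (\<forall>k\<in>{1..n}. \<forall>i. \<exists>\<^sub>\<le>\<^sub>1 j. primed k \<in> T (i, j))}"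

definition SSVT_P :: "nat list \<Rightarrow> nat list \<Rightarrow> nat \<Rightarrow> (nat \<times> nat \<Rightarrow> rat set) set" where
  "SSVT_P lam mu n =
     {T \<in> SSVT_Q lam mu n. \<forall>i. (i, i) \<in> diagram lam mu \<longrightarrow> T (i, i) \<subseteq> unprimed ` {1..n}}"

definition num_entries :: "nat list \<Rightarrow> nat list \<Rightarrow> (nat \<times> nat \<Rightarrow> rat set) \<Rightarrow> nat" where
  "num_entries lam mu T = (\<Sum>b\<in>diagram lam mu. card (T b))"

definition weight :: "nat list \<Rightarrow> nat list \<Rightarrow> (nat \<times> nat \<Rightarrow> rat set) \<Rightarrow> nat \<Rightarrow> nat" where
  "weight lam mu T k = (\<Sum>b\<in>diagram lam mu. card (T b \<inter> {primed k, unprimed k}))"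

subsection \<open>The generating functions\<close>

text \<open>
  The polynomials are given by their values at elements \<open>x 1, \<dots>, x n\<close> (variables) and
  \<open>b\<close> (parameter) of an arbitrary commutative ring.  Since the boxes of a tableau are nonempty,
  the subtraction in the exponent of \<open>b\<close> does not truncate when \<open>mu\<close> is contained in \<open>lam\<close>.
\<close>

definition GP :: "nat list \<Rightarrow> nat list \<Rightarrow> nat \<Rightarrow> (nat \<Rightarrow> 'a::comm_ring_1) \<Rightarrow> 'a \<Rightarrow> 'a" where
  "GP lam mu n x b =
     (\<Sum>T\<in>SSVT_P lam mu n.
        b ^ (num_entries lam mu T - skew_size lam mu) * (\<Prod>k=1..n. x k ^ weight lam mu T k))"

definition GQ :: "nat list \<Rightarrow> nat list \<Rightarrow> nat \<Rightarrow> (nat \<Rightarrow> 'a::comm_ring_1) \<Rightarrow> 'a \<Rightarrow> 'a" where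
  "GQ lam mu n x b =
     (\<Sum>T\<in>SSVT_Q lam mu n.
        b ^ (num_entries lam mu T - skew_size lam mu) * (\<Prod>k=1..n. x k ^ weight lam mu T k))"

subsection \<open>Laurent polynomials\<close>

text \<open>
  The ring of integer Laurent polynomials in one variable is the group ring of the additive group
  of integers: a finitely supported map from exponents to coefficients, with convolution product.
\<close>

type_synonym laurent_poly = "int \<Rightarrow>\<^sub>0 int"

definition beta :: laurent_poly where
  "beta = Poly_Mapping.single 1 1"

definition beta_inv :: laurent_poly where
  "beta_inv = Poly_Mapping.single (-1) 1"

lemma beta_mult_beta_inv: "beta * beta_inv = 1"
  by (simp add: beta_def beta_inv_def mult_single)

subsection \<open>Consistency of the definitions\<close>

lemma diagram_eq_Sigma:
  "diagram lam mu = (SIGMA i:{1..length lam}. {part mu i + i ..< part lam i + i})"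
  by (auto simp: diagram_def)

lemma finite_diagram: "finite (diagram lam mu)"
  by (simp add: diagram_eq_Sigma)

lemma sum_list_eq_sum_part:
  assumes "length lam \<le> m"
  shows "sum_list lam = (\<Sum>i=1..m. part lam i)"
proof -
  have "sum_list lam = (\<Sum>i<length lam. lam ! i)"
    by (simp add: sum_list_sum_nth atLeast0LessThan)
  also have "\<dots> = (\<Sum>i=1..length lam. part lam i)"
    by (rule sum.reindex_bij_witness[of _ "\<lambda>i. i - 1" Suc]) (auto simp: part_def)
  also have "\<dots> = (\<Sum>i=1..m. part lam i)"
    using assms by (intro sum.mono_neutral_left) (auto simp: part_def)
  finally show ?thesis .
qed

lemma part_contains_length:
  assumes "strict_partition mu" "part_contains lam mu"
  shows "length mu \<le> length lam"
proof (rule ccontr)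
  assume *: "\<not> length mu \<le> length lam"
  then have "part mu (length mu) > 0"
    using assms(1) by (auto simp: strict_partition_def part_def)
  moreover have "part lam (length mu) = 0"
    using * by (simp add: part_def)
  moreover have "part mu (length mu) \<le> part lam (length mu)"
    using assms(2) * by (auto simp: part_contains_def)
  ultimately show False by simp
qed

lemma skew_size_eq_card:
  assumes "strict_partition mu" "part_contains lam mu"
  shows "skew_size lam mu = card (diagram lam mu)"
proof -
  have "card (diagram lam mu) = (\<Sum>i=1..length lam. part lam i - part mu i)"
    by (simp add: diagram_eq_Sigma)
  also have "\<dots> = (\<Sum>i=1..length lam. part lam i) - (\<Sum>i=1..length lam. part mu i)"
    using assms(2) by (intro sum_subtractf_nat) (auto simp: part_contains_def)
  also have "\<dots> = skew_size lam mu"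
    using part_contains_length[OF assms]
    by (simp add: skew_size_def sum_list_eq_sum_part[of lam "length lam"]
        sum_list_eq_sum_part[of mu "length lam"])
  finally show ?thesis by simp
qed

lemma finite_alphabet: "finite (alphabet n)"
  by (simp add: alphabet_def)

lemma finite_SSVT_Q: "finite (SSVT_Q lam mu n)"
proof -
  have "finite {T. \<forall>b. (b \<in> diagram lam mu \<longrightarrow> T b \<in> Pow (alphabet n)) \<and>
                     (b \<notin> diagram lam mu \<longrightarrow> T b = {})}"
    by (rule finite_set_of_finite_funs) (simp_all add: finite_diagram finite_alphabet)
  then show ?thesis
    by (rule rev_finite_subset) (auto simp: SSVT_Q_def)
qed

lemma finite_SSVT_P: "finite (SSVT_P lam mu n)"
  by (simp add: SSVT_P_def finite_SSVT_Q)

lemma skew_size_le_num_entries: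
  assumes "strict_partition mu" "part_contains lam mu" "T \<in> SSVT_Q lam mu n"
  shows "skew_size lam mu \<le> num_entries lam mu T"
proof -
  have "card (T b) \<ge> 1" if "b \<in> diagram lam mu" for b
  proof -
    have "T b \<noteq> {}" "T b \<subseteq> alphabet n"
      using assms(3) that by (auto simp: SSVT_Q_def)
    then show ?thesis
      by (simp add: Suc_leI card_gt_0_iff finite_subset[OF _ finite_alphabet])
  qed
  then have "(\<Sum>b\<in>diagram lam mu. 1) \<le> num_entries lam mu T"
    unfolding num_entries_def by (rule sum_mono)
  then show ?thesis
    by (simp add: skew_size_eq_card[OF assms(1,2)])
qed

end

theory Submission
  imports Defs "HOL-Library.Product_Lexorder"
begin

text \<open>
  After the specialization every tableau \<open>T\<close> of shape \<open>D\<close> contributes \<open>(-1) ^ (|T| - |D|) * beta ^ |D|\<close>,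
  so the claim is that the signed count of tableaux is 1.  Let \<open>m b\<close> be the least entry that any
  tableau has in the box \<open>b\<close>.  The constraints between two boxes remain true when
  an entry of the earlier box is decreased, hence the boxwise singletons \<open>{m b}\<close> form a
  tableau.  For any other tableau \<open>T\<close>, take the lexicographically first box \<open>b\<close> with
  \<open>T b \<noteq> {m b}\<close> and insert \<open>m b\<close> into \<open>T b\<close> or remove it from there.  This is a sign-reversing
  involution whose only exception is the minimal tableau.
\<close>

subsection \<open>Signed counts of set-valued fillings\<close>

text \<open>The alphabet \<open>A b\<close> varies with the box so that conditions on single boxes
  can be put into it. Values off \<open>D\<close> are fixed, so each filling is one function.
  \<open>R\<close> is oriented by the linear order on boxes and need not be symmetric.\<close>

definition set_valued_fillings ::
  "'b::linorder set \<Rightarrow> ('b \<Rightarrow> 'c set) \<Rightarrow> ('b \<Rightarrow> 'b \<Rightarrow> 'c \<Rightarrow> 'c \<Rightarrow> bool) \<Rightarrow> ('b \<Rightarrow> 'c set) set" where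
  "set_valued_fillings D A R = {T.
     (\<forall>b\<in>D. T b \<noteq> {} \<and> T b \<subseteq> A b) \<and> (\<forall>b. b \<notin> D \<longrightarrow> T b = {}) \<and>
     (\<forall>a\<in>D. \<forall>b\<in>D. a < b \<longrightarrow> (\<forall>x\<in>T a. \<forall>y\<in>T b. R a b x y))}"

lemma finite_set_valued_fillings:
  assumes "finite D" and "\<And>b. b \<in> D \<Longrightarrow> finite (A b)"
  shows "finite (set_valued_fillings D A R)"
proof -
  have "finite {T. \<forall>b. (b \<in> D \<longrightarrow> T b \<in> Pow (\<Union>b\<in>D. A b)) \<and> (b \<notin> D \<longrightarrow> T b = {})}"
    using assms by (intro finite_set_of_finite_funs) auto
  then show ?thesis
    by (rule rev_finite_subset) (auto simp: set_valued_fillings_def)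
qed

text \<open>Reindexing along \<open>t\<close> gives \<open>sum f S = - sum f S\<close>, which forces
  0 over the integers. At a fixed point of \<open>t\<close> the value of \<open>f\<close> is
  0.\<close>

lemma sum_int_sign_reversing_involution:
  fixes f :: "'a \<Rightarrow> int"
  assumes "\<And>x. x \<in> S \<Longrightarrow> t x \<in> S" and "\<And>x. x \<in> S \<Longrightarrow> t (t x) = x"
    and "\<And>x. x \<in> S \<Longrightarrow> f (t x) = - f x"
  shows "sum f S = 0"
proof -
  have "sum f S = (\<Sum>x\<in>S. f (t x))"
    by (rule sum.reindex_bij_witness[of _ t t]) (use assms in auto)
  also have "\<dots> = - sum f S"
    using assms(3) by (simp add: sum_negf)
  finally show ?thesis by simp
qed

lemma minus_one_power_card_toggle:
  assumes "finite X"
  shows "(- 1 :: int) ^ card (if x \<in> X then X - {x} else insert x X) = - ((- 1) ^ card X)"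
proof (cases "x \<in> X")
  case True
  then have "card X = Suc (card (X - {x}))"
    using assms by (metis card_Suc_Diff1)
  then have "(- 1 :: int) ^ card X = - ((- 1) ^ card (X - {x}))"
    by (simp only: power_Suc)
  with True show ?thesis by (simp del: card_Diff_singleton)
qed (use assms in simp)

theorem signed_count_set_valued_fillings:
  fixes A :: "'b::linorder \<Rightarrow> 'c::linorder set"
  assumes finD: "finite D" and finA: "\<And>b. b \<in> D \<Longrightarrow> finite (A b)"
    and R_mono: "\<And>a b x x' y. R a b x y \<Longrightarrow> x' \<le> x \<Longrightarrow> R a b x' y"
    and nonempty: "set_valued_fillings D A R \<noteq> {}"
  shows "(\<Sum>T\<in>set_valued_fillings D A R. (- 1 :: int) ^ (\<Sum>b\<in>D. card (T b))) = (- 1) ^ card D"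
proof -
  define F where "F = set_valued_fillings D A R"
  define V where "V b = (\<Union>T\<in>F. T b)" for b
  \<comment> \<open>\<open>Min\<close> is meaningful on \<open>D\<close>, where \<open>V b\<close>
    is finite and nonempty. Off \<open>D\<close> the set \<open>V b\<close> is empty, and
    \<open>T0\<close> avoids \<open>m\<close> there.\<close>
  define m where "m b = Min (V b)" for b
  define T0 where "T0 b = (if b \<in> D then {m b} else {})" for b
  have F_iff: "T \<in> F \<longleftrightarrow> (\<forall>b\<in>D. T b \<noteq> {} \<and> T b \<subseteq> A b) \<and> (\<forall>b. b \<notin> D \<longrightarrow> T b = {}) \<and>
     (\<forall>a\<in>D. \<forall>b\<in>D. a < b \<longrightarrow> (\<forall>x\<in>T a. \<forall>y\<in>T b. R a b x y))" for T
    by (simp add: F_def set_valued_fillings_def)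
  have F_ne: "T b \<noteq> {}" and F_sub: "T b \<subseteq> A b" if "T \<in> F" "b \<in> D" for T b
    using that unfolding F_iff by blast+
  have F_off: "T b = {}" if "T \<in> F" "b \<notin> D" for T b
    using that unfolding F_iff by blast
  have F_R: "R a b x y" if "T \<in> F" "a \<in> D" "b \<in> D" "a < b" "x \<in> T a" "y \<in> T b" for T a b x y
    using that unfolding F_iff by blast
  have finF: "finite F"
    unfolding F_def by (rule finite_set_valued_fillings) (use finD finA in auto)
  have subA: "V b \<subseteq> A b" if "b \<in> D" for b
    unfolding V_def by (rule UN_least) (use that F_sub in auto)
  have finV: "finite (V b)" if "b \<in> D" for b
    using that subA finA finite_subset by metis
  have "V b \<noteq> {}" if "b \<in> D" for b
  proof -
    obtain T where "T \<in> F" using nonempty by (auto simp: F_def)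
    then have "T b \<noteq> {}" "T b \<subseteq> V b" using that F_ne by (auto simp: V_def)
    then show ?thesis by blast
  qed
  then have m_in: "m b \<in> V b" if "b \<in> D" for b
    using that finV by (simp add: m_def)
  have m_le: "m b \<le> x" if "b \<in> D" "T \<in> F" "x \<in> T b" for b T x
    unfolding m_def by (rule Min_le[OF finV]) (use that in \<open>auto simp: V_def\<close>)
  \<comment> \<open>The value \<open>m a\<close> may stem from a filling other than
    \<open>T\<close>, so an actual entry of \<open>T a\<close> is taken and lowered to
    \<open>m a\<close> by \<open>R_mono\<close>.\<close>
  have m_R: "R a b (m a) y" if "a \<in> D" "b \<in> D" "a < b" "T \<in> F" "y \<in> T b" for a b T y
  proof -
    obtain x where "x \<in> T a" using F_ne[OF \<open>T \<in> F\<close> \<open>a \<in> D\<close>] by blast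
    then have "R a b x y" "m a \<le> x" using that m_le F_R by auto
    then show ?thesis by (rule R_mono)
  qed
  have T0: "T0 \<in> F"
  proof -
    \<comment> \<open>Some filling attains \<open>m b\<close> in box \<open>b\<close>;
      \<open>m_R\<close> is applied to that filling.\<close>
    have "R a b (m a) (m b)" if "a \<in> D" "b \<in> D" "a < b" for a b
      using m_in[of b] that m_R by (auto simp: V_def)
    then show ?thesis
      using m_in subA by (simp add: F_iff T0_def subset_iff)
  qed
  define fb where "fb T = Min {b\<in>D. T b \<noteq> {m b}}" for T
  define tog where "tog x X = (if x \<in> X then X - {x} else insert x X)" for x :: 'c and X
  define t where "t T = T(fb T := tog (m (fb T)) (T (fb T)))" for T
  let ?f = "\<lambda>T. (- 1 :: int) ^ (\<Sum>b\<in>D. card (T b))"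
  have fb: "fb T \<in> D" "T (fb T) \<noteq> {m (fb T)}" "\<And>a. a \<in> D \<Longrightarrow> a < fb T \<Longrightarrow> T a = {m a}"
    if "T \<in> F - {T0}" for T
  proof -
    have "\<exists>b\<in>D. T b \<noteq> {m b}"
    proof (rule ccontr)
      assume "\<not> (\<exists>b\<in>D. T b \<noteq> {m b})"
      then have "T = T0" using that F_off by (auto simp: T0_def fun_eq_iff)
      with that show False by simp
    qed
    then have "fb T \<in> {b\<in>D. T b \<noteq> {m b}}"
      unfolding fb_def using finD by (intro Min_in) auto
    then show "fb T \<in> D" "T (fb T) \<noteq> {m (fb T)}" by auto
    show "T a = {m a}" if "a \<in> D" "a < fb T" for a
    proof (rule ccontr)
      assume "T a \<noteq> {m a}"
      then have "fb T \<le> a" unfolding fb_def using finD that(1) by (intro Min_le) auto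
      with that(2) show False by simp
    qed
  qed
  \<comment> \<open>Toggling \<open>x\<close> exchanges \<open>{x}\<close> and \<open>{}\<close>, so
    a set different from both stays different from both.\<close>
  have tog_ne: "tog x X \<noteq> {x} \<and> tog x X \<noteq> {}" if "X \<noteq> {x}" "X \<noteq> {}" for x X
    using that by (auto simp: tog_def)
  have tog_sub: "tog x X \<subseteq> insert x X" for x X
    by (auto simp: tog_def)
  have t_in: "t T \<in> F" and fb_t: "fb (t T) = fb T" and tt: "t (t T) = T"
    and t_ne: "t T \<noteq> T0" and ft: "?f (t T) = - ?f T"
    if T: "T \<in> F - {T0}" for T
  proof -
    note fbT = fb[OF T]
    have TF: "T \<in> F" using T by simp
    have tb: "T (fb T) \<noteq> {}" "T (fb T) \<subseteq> A (fb T)" using F_ne[OF TF] F_sub[OF TF] fbT(1) by auto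
    note ne = tog_ne[OF fbT(2) tb(1)]
    have sub: "t T b \<subseteq> insert (m b) (T b)" for b
      using tog_sub by (auto simp: t_def)
    have sub': "t T b \<subseteq> T b" if "b \<noteq> fb T" for b
      using that by (auto simp: t_def)
    have R: "R a b x y" if *: "a \<in> D" "b \<in> D" "a < b" "x \<in> t T a" "y \<in> t T b" for a b x y
    \<comment> \<open>The later entry is the delicate one, since \<open>R_mono\<close> lowers only
      the earlier. If it lies in the toggled box, all earlier boxes hold just their minima, and an
      inserted \<open>m b\<close> is covered by \<open>T0\<close>.\<close>
    proof (cases "b = fb T")
      case True
      with * have "T a = {m a}" and "x \<in> T a"
        using fbT(3) sub'[of a] by auto
      then have "x = m a" by auto
      moreover have "y \<in> T b \<or> y = m b" using sub * by auto
      moreover have "m b \<in> T0 b" using * by (simp add: T0_def)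
      ultimately show ?thesis using m_R[OF *(1-3)] TF T0 by blast
    next
      case False
      with * have "y \<in> T b" using sub' by auto
      moreover have "x \<in> T a \<or> x = m a" using sub * by auto
      ultimately show ?thesis using m_R[OF *(1-3) TF] F_R[OF TF *(1-3)] by auto
    qed
    have "t T b \<subseteq> A b" if "b \<in> D" for b
      using sub[of b] m_in[OF that] subA[OF that] F_sub[OF TF that] by blast
    moreover have "t T b \<noteq> {}" if "b \<in> D" for b
      using ne F_ne[OF TF that] by (auto simp: t_def)
    moreover have "t T b = {}" if "b \<notin> D" for b
      using fbT(1) F_off[OF TF that] that by (auto simp: t_def)
    ultimately show "t T \<in> F"
      using R unfolding F_iff by blast
    \<comment> \<open>The toggled box remains nonminimal, so a second toggle acts on the same box
      and undoes the first.\<close>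
    have "{b\<in>D. t T b \<noteq> {m b}} = {b\<in>D. T b \<noteq> {m b}}"
      using ne fbT by (auto simp: t_def)
    then show fb_t: "fb (t T) = fb T" by (simp add: fb_def)
    show "t (t T) = T"
      unfolding t_def[of "t T"] fb_t by (auto simp: t_def tog_def fun_eq_iff)
    have "t T (fb T) \<noteq> T0 (fb T)"
      using ne fbT(1) by (simp add: t_def T0_def)
    then show "t T \<noteq> T0" by auto
    have "(\<Sum>b\<in>D. card (T b)) = card (T (fb T)) + (\<Sum>b\<in>D - {fb T}. card (T b))"
      using finD fbT(1) by (simp add: sum.remove)
    moreover have "(\<Sum>b\<in>D. card (t T b)) = card (t T (fb T)) + (\<Sum>b\<in>D - {fb T}. card (T b))"
      using finD fbT(1) by (subst sum.remove[of _ "fb T"]) (auto simp: t_def)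
    moreover have "(- 1 :: int) ^ card (t T (fb T)) = - ((- 1) ^ card (T (fb T)))"
      using minus_one_power_card_toggle[of "T (fb T)" "m (fb T)"] finite_subset[OF tb(2) finA] fbT(1)
      by (simp add: t_def tog_def)
    ultimately show "?f (t T) = - ?f T"
      by (simp add: power_add)
  qed
  have "sum ?f (F - {T0}) = 0"
    by (rule sum_int_sign_reversing_involution[where t = t]) (use t_in tt t_ne ft in auto)
  then have "sum ?f F = ?f T0"
    using T0 finF by (simp add: sum.remove)
  also have "(\<Sum>b\<in>D. card (T0 b)) = card D"
    by (simp add: T0_def)
  finally show ?thesis by (simp add: F_def)
qed

subsection \<open>Shifted tableaux as set-valued fillings\<close>

lemma diagram_row_contiguous:
  assumes "(i, j) \<in> diagram lam mu" "(i, j') \<in> diagram lam mu" "j \<le> k" "k \<le> j'"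
  shows "(i, k) \<in> diagram lam mu"
  using assms by (auto simp: diagram_def)

lemma strict_partition_part_pos:
  assumes "strict_partition lam" "1 \<le> i" "i \<le> length lam"
  shows "0 < part lam i"
  using assms by (simp add: strict_partition_def part_def)

text \<open>Zero padding makes consecutive values equal past the last part, hence the positivity
  premise; the successor of the last part is the padded 0.\<close>

lemma strict_partition_part_Suc:
  assumes "strict_partition lam" "1 \<le> i" "0 < part lam i"
  shows "part lam (Suc i) < part lam i"
proof (cases "Suc i \<le> length lam")
  case True
  then show ?thesis
    using assms sorted_wrt_nth_less[of "(>)" lam "i - 1" i]
    by (auto simp: strict_partition_def part_def)
qed (use assms in \<open>simp add: part_def\<close>)

text \<open>By strictness, \<open>part lam k + k\<close> and \<open>part mu k + k\<close> weakly
  decrease in \<open>k\<close> while the parts are positive. So the upper bound on \<open>j\<close>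
  passes up from row \<open>i'\<close>, and the lower bound passes down from row
  \<open>i\<close>.\<close>

lemma diagram_column_contiguous:
  assumes "strict_partition lam" "strict_partition mu"
    and "(i, j) \<in> diagram lam mu" "(i', j) \<in> diagram lam mu" "i \<le> k" "k \<le> i'"
  shows "(k, j) \<in> diagram lam mu"
proof -
  have i': "1 \<le> i'" "i' \<le> length lam" "i' \<le> j" "j \<le> part lam i' + i' - 1"
    using assms(4) by (auto simp: diagram_def)
  have "k \<le> i' \<longrightarrow> part mu k + k \<le> j"
    using \<open>i \<le> k\<close>
  proof (induction k rule: dec_induct)
    case base
    then show ?case using assms(3) by (simp add: diagram_def)
  next
    case (step k)
    have "1 \<le> k" using assms(3) step(1) by (simp add: diagram_def)
    show ?case
    \<comment> \<open>Once \<open>mu\<close> is exhausted, \<open>part mu k + k\<close> is just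
      \<open>k\<close> and grows, but it stays at most \<open>i'\<close>, and
      \<open>i' \<le> j\<close> because row \<open>i'\<close> has a box in column
      \<open>j\<close>.\<close>
    proof (cases "part mu k = 0")
      case True
      then have "length mu < k"
        using strict_partition_part_pos[OF assms(2) \<open>1 \<le> k\<close>] by force
      then have "part mu (Suc k) = 0" by (simp add: part_def)
      with i' show ?thesis by simp
    next
      case False
      then show ?thesis
        using step \<open>1 \<le> k\<close> strict_partition_part_Suc[OF assms(2), of k] by fastforce
    qed
  qed
  moreover have "1 \<le> k \<longrightarrow> j < part lam k + k"
    using \<open>k \<le> i'\<close>
  proof (induction k rule: inc_induct)
    case base
    then show ?case using i' by linarith
  next
    case (step k)
    have "0 < part lam k" if "1 \<le> k"
      using step(2) i' that by (intro strict_partition_part_pos[OF assms(1)]) auto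
    then show ?case
      using step strict_partition_part_Suc[OF assms(1), of k] by fastforce
  qed
  ultimately show ?thesis
    using assms(3,5,6) i' by (auto simp: diagram_def)
qed

text \<open>
  Here \<open>x\<close> is an entry of the lexicographically earlier box \<open>a\<close>.  Relating all pairs of boxes in a
  row or column, not only neighbours, absorbs the conditions on repeated entries into one relation
  that is preserved when \<open>x\<close> decreases.
\<close>

definition shifted_compatible :: "nat \<Rightarrow> nat \<times> nat \<Rightarrow> nat \<times> nat \<Rightarrow> rat \<Rightarrow> rat \<Rightarrow> bool" where
  "shifted_compatible n a b x y \<longleftrightarrow>
     (fst a = fst b \<longrightarrow> x < y \<or> x = y \<and> x \<notin> primed ` {1..n}) \<and>
     (snd a = snd b \<longrightarrow> x < y \<or> x = y \<and> x \<notin> unprimed ` {1..n})"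

text \<open>Transitivity passes through a witness in each intermediate set, which is why these are
  nonempty. This extends tableau inequalities from adjacent boxes to arbitrary boxes of a row or
  column.\<close>

lemma chain_le:
  fixes X :: "nat \<Rightarrow> 'a::preorder set"
  assumes "i < k" and "\<And>j. i < j \<Longrightarrow> j < k \<Longrightarrow> X j \<noteq> {}"
    and "\<And>j x y. i \<le> j \<Longrightarrow> j < k \<Longrightarrow> x \<in> X j \<Longrightarrow> y \<in> X (Suc j) \<Longrightarrow> x \<le> y"
    and "x \<in> X i" "y \<in> X k"
  shows "x \<le> y"
proof -
  have "\<forall>y\<in>X l. x \<le> y" if "Suc i \<le> l" "l \<le> k" for l
    using that
  proof (induction l rule: dec_induct)
    case base
    then show ?case using assms(3)[of i] assms(4) by auto
  next
    case (step l)
    then obtain z where "z \<in> X l" using assms(2)[of l] by auto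
    with step assms(3)[of l] show ?case by (auto intro: order_trans)
  qed
  from this[of k] show ?thesis using assms(1,5) by auto
qed

text \<open>Since rows and columns have no gaps, \<open>chain_le\<close> compares distant boxes, and
  the uniqueness conditions exclude the forbidden equalities. Conversely, adjacent boxes yield the
  \<open>Max\<close> and \<open>Min\<close> inequalities, and equal entries yield uniqueness. The
  lexicographic order runs left to right in a row and top to bottom in a column.\<close>

lemma SSVT_Q_eq:
  assumes "strict_partition lam" "strict_partition mu"
  shows "SSVT_Q lam mu n =
    set_valued_fillings (diagram lam mu) (\<lambda>_. alphabet n) (shifted_compatible n)"
proof (intro equalityI subsetI)
  fix T assume T: "T \<in> SSVT_Q lam mu n"
  let ?D = "diagram lam mu"
  have ne: "T b \<noteq> {}" and fin: "finite (T b)" if "b \<in> ?D" for b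
    using T that finite_subset[OF _ finite_alphabet] by (auto simp: SSVT_Q_def)
  have off: "T b = {}" if "b \<notin> ?D" for b
    using T that unfolding SSVT_Q_def by blast
  have row1: "x \<le> y" if "x \<in> T (i, j)" "y \<in> T (i, Suc j)" for i j x y
  proof -
    have D: "(i, j) \<in> ?D" "(i, Suc j) \<in> ?D" using that off by blast+
    then have "Max (T (i, j)) \<le> Min (T (i, Suc j))"
      using T by (auto simp: SSVT_Q_def)
    moreover have "x \<le> Max (T (i, j))" "Min (T (i, Suc j)) \<le> y"
      using that fin D by auto
    ultimately show ?thesis by linarith
  qed
  have col1: "x \<le> y" if "x \<in> T (i, j)" "y \<in> T (Suc i, j)" for i j x y
  proof -
    have D: "(i, j) \<in> ?D" "(Suc i, j) \<in> ?D" using that off by blast+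
    then have "Max (T (i, j)) \<le> Min (T (Suc i, j))"
      using T by (auto simp: SSVT_Q_def)
    moreover have "x \<le> Max (T (i, j))" "Min (T (Suc i, j)) \<le> y"
      using that fin D by auto
    ultimately show ?thesis by linarith
  qed
  have row: "x < y \<or> x = y \<and> x \<notin> primed ` {1..n}"
    if "j < j'" "(i, j) \<in> ?D" "(i, j') \<in> ?D" "x \<in> T (i, j)" "y \<in> T (i, j')" for i j j' x y
  proof -
    have "x \<le> y"
      by (rule chain_le[of j j' "\<lambda>j. T (i, j)"])
        (use that row1 ne diagram_row_contiguous[OF that(2,3)] in auto)
    moreover have "x \<notin> primed ` {1..n}" if "x = y"
    proof
      assume "x \<in> primed ` {1..n}"
      then have "\<exists>\<^sub>\<le>\<^sub>1 j. x \<in> T (i, j)" using T by (auto simp: SSVT_Q_def)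
      then have "j = j'" using \<open>x \<in> T (i, j)\<close> \<open>y \<in> T (i, j')\<close> \<open>x = y\<close> by (auto dest: Uniq_D)
      with \<open>j < j'\<close> show False by simp
    qed
    ultimately show ?thesis by auto
  qed
  have col: "x < y \<or> x = y \<and> x \<notin> unprimed ` {1..n}"
    if "i < i'" "(i, j) \<in> ?D" "(i', j) \<in> ?D" "x \<in> T (i, j)" "y \<in> T (i', j)" for i i' j x y
  proof -
    have "x \<le> y"
      by (rule chain_le[of i i' "\<lambda>i. T (i, j)"])
        (use that col1 ne diagram_column_contiguous[OF assms that(2,3)] in auto)
    moreover have "x \<notin> unprimed ` {1..n}" if "x = y"
    proof
      assume "x \<in> unprimed ` {1..n}"
      then have "\<exists>\<^sub>\<le>\<^sub>1 i. x \<in> T (i, j)" using T by (auto simp: SSVT_Q_def)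
      then have "i = i'" using \<open>x \<in> T (i, j)\<close> \<open>y \<in> T (i', j)\<close> \<open>x = y\<close> by (auto dest: Uniq_D)
      with \<open>i < i'\<close> show False by simp
    qed
    ultimately show ?thesis by auto
  qed
  have "shifted_compatible n a b x y"
    if "a \<in> ?D" "b \<in> ?D" "a < b" "x \<in> T a" "y \<in> T b" for a b x y
    using that row[of "snd a" "snd b" "fst a" x y] col[of "fst a" "fst b" "snd a" x y]
    by (cases a; cases b) (auto simp: shifted_compatible_def)
  then show "T \<in> set_valued_fillings ?D (\<lambda>_. alphabet n) (shifted_compatible n)"
    using T by (auto simp: set_valued_fillings_def SSVT_Q_def)
next
  fix T assume T: "T \<in> set_valued_fillings (diagram lam mu) (\<lambda>_. alphabet n) (shifted_compatible n)"
  let ?D = "diagram lam mu"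
  have ne: "T b \<noteq> {}" and fin: "finite (T b)" if "b \<in> ?D" for b
    using T that finite_subset[OF _ finite_alphabet] by (auto simp: set_valued_fillings_def)
  have off: "T b = {}" if "b \<notin> ?D" for b
    using T that unfolding set_valued_fillings_def by blast
  have R: "shifted_compatible n a b x y" if "a < b" "x \<in> T a" "y \<in> T b" for a b x y
  proof -
    have "a \<in> ?D" "b \<in> ?D" using that off by blast+
    then show ?thesis using T that by (auto simp: set_valued_fillings_def)
  qed
  have row: "Max (T (i, j)) \<le> Min (T (i, j + 1))"
    if "(i, j) \<in> ?D" "(i, j + 1) \<in> ?D" for i j
  proof -
    have "x \<le> y" if "x \<in> T (i, j)" "y \<in> T (i, j + 1)" for x y
      using R[OF _ that] by (auto simp: shifted_compatible_def)
    then show ?thesis using that ne fin by simp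
  qed
  have col: "Max (T (i, j)) \<le> Min (T (i + 1, j))"
    if "(i, j) \<in> ?D" "(i + 1, j) \<in> ?D" for i j
  proof -
    have "x \<le> y" if "x \<in> T (i, j)" "y \<in> T (i + 1, j)" for x y
      using R[OF _ that] by (auto simp: shifted_compatible_def)
    then show ?thesis using that ne fin by simp
  qed
  have ucol: "\<exists>\<^sub>\<le>\<^sub>1 i. unprimed k \<in> T (i, j)" if "k \<in> {1..n}" for k j
  proof (rule Uniq_I)
    \<comment> \<open>The relation is imposed only with the earlier box first, so a repetition is
      refuted for \<open>i < i'\<close> and the result is used in both orders.\<close>
    have no: "\<not> (i < i' \<and> unprimed k \<in> T (i, j) \<and> unprimed k \<in> T (i', j))" for i i'
      using R[of "(i, j)" "(i', j)" "unprimed k" "unprimed k"] that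
      by (auto simp: shifted_compatible_def)
    fix i i' assume "unprimed k \<in> T (i, j)" "unprimed k \<in> T (i', j)"
    then show "i = i'" using no[of i i'] no[of i' i] by linarith
  qed
  have urow: "\<exists>\<^sub>\<le>\<^sub>1 j. primed k \<in> T (i, j)" if "k \<in> {1..n}" for k i
  proof (rule Uniq_I)
    have no: "\<not> (j < j' \<and> primed k \<in> T (i, j) \<and> primed k \<in> T (i, j'))" for j j'
      using R[of "(i, j)" "(i, j')" "primed k" "primed k"] that
      by (auto simp: shifted_compatible_def)
    fix j j' assume "primed k \<in> T (i, j)" "primed k \<in> T (i, j')"
    then show "j = j'" using no[of j j'] no[of j' j] by linarith
  qed
  show "T \<in> SSVT_Q lam mu n"
    unfolding SSVT_Q_def
    using T row col ucol urow by (auto simp: set_valued_fillings_def)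
qed

text \<open>The diagonal condition restricts single boxes, so it is absorbed into their alphabets;
  the relation between boxes is the one for \<open>SSVT_Q\<close>.\<close>

lemma SSVT_P_eq:
  assumes "strict_partition lam" "strict_partition mu"
  shows "SSVT_P lam mu n =
    set_valued_fillings (diagram lam mu)
      (\<lambda>b. if fst b = snd b then unprimed ` {1..n} else alphabet n) (shifted_compatible n)"
proof -
  have diagonal: "(\<forall>b\<in>diagram lam mu. T b \<noteq> {} \<and> T b \<subseteq> alphabet n) \<and>
      (\<forall>i. (i, i) \<in> diagram lam mu \<longrightarrow> T (i, i) \<subseteq> unprimed ` {1..n}) \<longleftrightarrow>
    (\<forall>b\<in>diagram lam mu. T b \<noteq> {} \<and>
      T b \<subseteq> (if fst b = snd b then unprimed ` {1..n} else alphabet n))"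
    for T :: "nat \<times> nat \<Rightarrow> rat set"
  proof -
    have "unprimed ` {1..n} \<subseteq> alphabet n" by (simp add: alphabet_def)
    then show ?thesis by (auto split: if_splits) blast+
  qed
  show ?thesis
    by (simp only: SSVT_P_def SSVT_Q_eq[OF assms] set_valued_fillings_def mem_Collect_eq
        diagonal[symmetric] conj_ac)
qed

subsection \<open>The specialization\<close>

lemma primed_neq_unprimed: "primed k \<noteq> unprimed l"
proof
  assume "primed k = unprimed l"
  then have "(of_nat (2 * k) :: rat) = of_nat (2 * l + 1)"
    by (simp add: primed_def unprimed_def field_simps)
  then have "2 * k = 2 * l + 1" by (simp only: of_nat_eq_iff)
  then show False by presburger
qed

text \<open>The pairs of \<open>primed k\<close> and \<open>unprimed k\<close> partition the
  alphabet. With equal variables the monomial of a tableau thus depends only on its number of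
  entries.\<close>

lemma sum_weight:
  assumes "T \<in> SSVT_Q lam mu n"
  shows "(\<Sum>k=1..n. weight lam mu T k) = num_entries lam mu T"
proof -
  have "(\<Sum>k=1..n. card (T b \<inter> {primed k, unprimed k})) = card (T b)"
    if "b \<in> diagram lam mu" for b
  proof -
    have "T b = (\<Union>k\<in>{1..n}. T b \<inter> {primed k, unprimed k})"
      using assms that by (auto simp: SSVT_Q_def alphabet_def)
    moreover have "card (\<Union>k\<in>{1..n}. T b \<inter> {primed k, unprimed k}) =
        (\<Sum>k=1..n. card (T b \<inter> {primed k, unprimed k}))"
      using primed_neq_unprimed
      by (intro card_UN_disjoint) (auto simp: primed_def unprimed_def)
    ultimately show ?thesis by simp
  qed
  then show ?thesis
    unfolding weight_def num_entries_def by (subst sum.swap) simp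
qed

text \<open>If \<open>d\<close> counts the excess entries, \<open>beta_inv ^ d\<close> cancels
  \<open>beta ^ d\<close>. Writing the rest with \<open>- beta\<close> turns the sign into the
  parity of \<open>num_entries\<close> and leaves a factor common to all tableaux.\<close>

lemma specialized_term:
  assumes "strict_partition mu" "part_contains lam mu" "T \<in> SSVT_Q lam mu n"
  shows "(- beta_inv) ^ (num_entries lam mu T - skew_size lam mu) *
      (\<Prod>k=1..n. beta ^ weight lam mu T k) =
    of_int ((- 1) ^ num_entries lam mu T) * (- beta) ^ skew_size lam mu"
proof -
  obtain d where d: "num_entries lam mu T = skew_size lam mu + d"
    using skew_size_le_num_entries[OF assms] le_Suc_ex by blast
  have "(\<Prod>k=1..n. beta ^ weight lam mu T k) = beta ^ num_entries lam mu T"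
    by (simp only: power_sum[symmetric] sum_weight[OF assms(3)])
  moreover have "(- beta_inv) ^ d * beta ^ d = (- 1) ^ d"
    by (simp add: power_mult_distrib[symmetric] mult.commute[of beta_inv] beta_mult_beta_inv)
  ultimately show ?thesis
    by (simp add: d power_add power_minus[of beta] mult.assoc[symmetric] mult.left_commute)
qed

text \<open>This serves both families of tableaux at once, since they differ only in the alphabets
  \<open>A\<close>.\<close>

lemma specialized_sum:
  assumes "strict_partition mu" "part_contains lam mu"
    and "F \<subseteq> SSVT_Q lam mu n" and "F \<noteq> {}"
    and F: "F = set_valued_fillings (diagram lam mu) A (shifted_compatible n)"
    and "\<And>b. A b \<subseteq> alphabet n"
  shows "(\<Sum>T\<in>F. (- beta_inv) ^ (num_entries lam mu T - skew_size lam mu) *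
      (\<Prod>k=1..n. beta ^ weight lam mu T k)) = beta ^ skew_size lam mu"
proof -
  have "(\<Sum>T\<in>F. (- 1 :: int) ^ num_entries lam mu T) = (- 1) ^ skew_size lam mu"
    unfolding F num_entries_def skew_size_eq_card[OF assms(1,2)]
  proof (rule signed_count_set_valued_fillings)
    show "finite (A b)" for b
      using assms(6) finite_alphabet by (rule finite_subset)
    \<comment> \<open>A strictly lowered entry satisfies the strict alternatives, so the exclusions
      for equal entries cannot newly apply.\<close>
    show "shifted_compatible n a b x' y" if "shifted_compatible n a b x y" "x' \<le> x" for a b x x' y
      using that by (auto simp: shifted_compatible_def)
    show "set_valued_fillings (diagram lam mu) A (shifted_compatible n) \<noteq> {}"
      using \<open>F \<noteq> {}\<close> F by simp
  qed (rule finite_diagram)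
  note signed_count = this
  have "(\<Sum>T\<in>F. (- beta_inv) ^ (num_entries lam mu T - skew_size lam mu) *
      (\<Prod>k=1..n. beta ^ weight lam mu T k)) =
    (\<Sum>T\<in>F. of_int ((- 1) ^ num_entries lam mu T) * (- beta) ^ skew_size lam mu)"
    using assms(3) by (intro sum.cong specialized_term[OF assms(1,2)]) auto
  also have "\<dots> = of_int (\<Sum>T\<in>F. (- 1) ^ num_entries lam mu T) * (- beta) ^ skew_size lam mu"
    by (simp only: of_int_sum sum_distrib_right)
  \<comment> \<open>The signed count is \<open>(- 1) ^ skew_size lam mu\<close>, which cancels the
    sign in \<open>(- beta) ^ skew_size lam mu\<close>.\<close>
  also have "\<dots> = beta ^ skew_size lam mu"
    unfolding signed_count by (simp add: power_mult_distrib[symmetric])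
  finally show ?thesis .
qed

theorem theorem4p1:
  fixes lam mu :: "nat list" and n :: nat
  assumes "strict_partition lam" and "strict_partition mu"
    and "part_contains lam mu"
    and "n \<ge> 1"
    and "SSVT_P lam mu n \<noteq> {}" and "SSVT_Q lam mu n \<noteq> {}"
  shows "GP lam mu n (\<lambda>_. beta) (- beta_inv) = beta ^ skew_size lam mu
       \<and> GQ lam mu n (\<lambda>_. beta) (- beta_inv) = beta ^ skew_size lam mu"
proof
  show "GP lam mu n (\<lambda>_. beta) (- beta_inv) = beta ^ skew_size lam mu"
    unfolding GP_def
    by (rule specialized_sum[OF assms(2,3) _ assms(5) SSVT_P_eq[OF assms(1,2)]])
      (auto simp: SSVT_P_def alphabet_def)
  show "GQ lam mu n (\<lambda>_. beta) (- beta_inv) = beta ^ skew_size lam mu"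
    unfolding GQ_def
    by (rule specialized_sum[OF assms(2,3) _ assms(6) SSVT_Q_eq[OF assms(1,2)]]) auto
qed

end
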